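(* Let $\Sigma$ be a totally ordered alphabet with $k=|\Sigma|$ and let $\mathcal{A}=(S\cup\{\Omega\},\Sigma,\delta,s_0,F)$ be an ADFA with $n=|S|\ge 2$ and $\mathrm{rk}(\mathcal{A})=d$. Let $(s_i)_{i\in[0,(k+1)(n+1)[}$, with $s_i\in[0,n[$, be the string representation of $\mathcal{A}$ obtained using the characteristic word function $\Psi_c$. Let $(r_l)_{l\in[0,d]}$ be the sequence of the first states of each rank (i.e. $r_l$ is the least number $\varphi(s)$ of a state $s\in S$ of rank $l$), with the conventions $r_{-1}=0$, $r_{d+1}=n+1$, and let $(f_i)_{i\in[1,n[}$ be the sequence of the positions in $(s_i)_i$ of the first occurrence of each $i\in[1,n[$ (among the transition positions $(k+1)j+m$, $j\in[0,n]$, $m\in[0,k[$). Then the following conditions are satisfied: (N0) $s_0=\cdots=s_k=\cdots=s_{2k}=0$ and $s_{2k+1}=1$; (N1) for all $i\in[0,n]$, $s_{(k+1)i+k}\in\{0,1\}$; (N2) $r_0=1$, $r_1=2$, $r_d=n$, and $r_l<r_{l+1}$ for all $l\in[0,d[$; (N3) for all $i\in[1,n[$: $s_{f_i}=i$, and for all $j\in[0,n]$ and $m\in[0,k[$, if $(k+1)j+m<f_i$ then $s_{(k+1)j+m}\ne i$; (N4) for all $l\in[0,d[$ and all $i\in[r_l,r_{l+1}[$: $kr_{l+1}+1\le f_i$; (N5) for all $l\in[0,d]$ and all $i\in[r_l,r_{l+1}[$ there is $m\in[0,k[$ with $s_{(k+1)i+m}\in[r_{l-1},r_l[$; (N6')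 for all $l\in[0,d[$ and all $i\in R_l$: $i\prec_{\Psi_c} i+1$, where states are identified with their numbers under $\varphi$.
   Context: Intervals are intervals of integers: $[a,b]=\{i\in\mathbb{Z}: a\le i\le b\}$, $[a,b[=\{i\in\mathbb{Z}: a\le i<b\}$. Lexicographic order on finite sequences over a totally ordered set: compare at the first differing position; a proper prefix is smaller. An ADFA (trim complete acyclic deterministic finite automaton) is a complete DFA $\mathcal{A}=(S\cup\{\Omega\},\Sigma,\delta,s_0,F)$ with $\Omega\notin S$, $F\subseteq S$, $s_0\neq\Omega$, total transition function $\delta$ (extended to words as usual), such that: $\delta(\Omega,\sigma)=\Omega$ for all $\sigma\in\Sigma$; $\delta(s,x)\ne s$ for all $s\in S$ and all nonempty words $x$; every $s\in S$ is reachable from $s_0$; and from every $s\in S$ some state of $F$ is reachable (by a possibly empty word). Its number of states is $n=|S|$. Rank: $\mathrm{rk}(s)$, for $s\in S$, is the length of the longest word $x$ with $\delta(s,x)\in F$; $\mathrm{rk}(\mathcal{A})=\max_{s\in S}\mathrm{rk}(s)$; $R_l=\{s\in S:\mathrm{rk}(s)=l\}$. Characteristic word: for $s\in S$ and a word $\sigma_l\cdots\sigma_0$ with $\delta(s_0,\sigma_l\cdots\sigma_0)=s$, follow the path backwards from $s$ to $s_0$ and let $\tau_j=(\mathrm{rk}(p_j),\sigma_j,f_{p_j})$, where $p_j=\delta(s_0,\sigma_l\cdots\sigma_{j+1})$ is the state of the path from which the letter $\sigma_j$ is read and $f_p=1$ if $p\in F$, $f_p=0$ otherwise. Let $\mathcal{L}_L^{rk}(s)$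 be the set of all sequences $\tau_0\tau_1\cdots\tau_l$ so obtained (the empty word gives the empty sequence, for $s=s_0$). Then $\Psi_c(s)=\min \mathcal{L}_L^{rk}(s)$, the minimum being lexicographic, with triples $\tau$ themselves compared lexicographically (order of integers, order of $\Sigma$, $0<1$). Numbering and string representation: let $\Pi:\Sigma\to[0,k[$ be the order-preserving bijection. The numbering $\varphi:S\cup\{\Omega\}\to[0,n]$ is defined by $\varphi(\Omega)=0$ and then, for $l=0,1,\dots,\mathrm{rk}(\mathcal{A})$ successively, the states of $R_l$ receive the next consecutive unused integers (starting with $1$) in increasing order for $\prec_{\Psi_c}$. Here, for a state $s$, $\Delta(s)=(\varphi(\delta(s,\Pi^{-1}(0))),\dots,\varphi(\delta(s,\Pi^{-1}(k-1))),f)$ with $f=1$ if $s\in F$ and $f=0$ otherwise (transitions from $s\in S$ go to $\Omega$ or to states of lower rank, which are already numbered), and $s\prec_{\Psi_c}s'$ iff $\Delta(s)<\Delta(s')$ lexicographically, or $\Delta(s)=\Delta(s')$ and $\Psi_c(s)<\Psi_c(s')$ lexicographically. The string representation $(s_i)_{i\in[0,(k+1)(n+1)[}$ of $\mathcal{A}$ is the concatenation of the tuples $\Delta(\varphi^{-1}(0)),\Delta(\varphi^{-1}(1)),\dots,\Delta(\varphi^{-1}(n))$.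
   Formalization: In (N2), r_1 = 2 is claimed only when exactly one state has rank 0 (it is false otherwise); in (N6'), i ≺ i+1 is claimed only when i and i+1 both lie in R_l, since it can fail when i is the last state of its rank. *)

theory Defs
  imports Main "HOL-Library.List_Lexorder" "HOL-Library.Product_Lexorder"
begin

text \<open>
  The alphabet is a type of sort \<open>{finite, linorder}\<close>. The lexicographic orders on words, on
  sequences of triples and on tuples of numbers are the library instances of \<open>(<)\<close> on lists
  (a proper prefix is smaller) and on pairs; triples are nested pairs.
\<close>

text \<open>
  \<open>states\<close> is the set \<open>S\<close>, which does not contain the state \<open>sink\<close> (\<open>\<Omega>\<close>). Only the
  restriction of \<open>delta\<close> to \<open>S \<union> {\<Omega>}\<close> is relevant.
\<close>

record ('q, 'a) dfa =
  states :: "'q set"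
  sink   :: 'q
  delta  :: "'q \<Rightarrow> 'a \<Rightarrow> 'q"
  start  :: 'q
  finals :: "'q set"

definition run :: "('q, 'a) dfa \<Rightarrow> 'q \<Rightarrow> 'a list \<Rightarrow> 'q" where
  "run A p w = foldl (delta A) p w"

locale adfa =
  fixes A :: "('q, 'a::{finite,linorder}) dfa"
  assumes finite_states: "finite (states A)"
    and sink_notin: "sink A \<notin> states A"
    and finals_subset: "finals A \<subseteq> states A"
    and start_in: "start A \<in> states A \<union> {sink A}"
    and start_not_sink: "start A \<noteq> sink A"
    and delta_closed: "\<And>p a. p \<in> states A \<union> {sink A} \<Longrightarrow> delta A p a \<in> states A \<union> {sink A}"
    and delta_sink: "\<And>a. delta A (sink A) a = sink A"
    and acyclic: "\<And>p w. p \<in> states A \<Longrightarrow> w \<noteq> [] \<Longrightarrow> run A p w \<noteq> p"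
    and accessible: "\<And>p. p \<in> states A \<Longrightarrow> \<exists>w. run A (start A) w = p"
    and coaccessible: "\<And>p. p \<in> states A \<Longrightarrow> \<exists>w. run A p w \<in> finals A"

text \<open>
  In an ADFA, the sets below whose maximum or minimum is taken are finite and nonempty: by
  acyclicity, a word leading from a state of \<open>S\<close> to a state of \<open>S\<close> is shorter than \<open>card S\<close>.
\<close>

definition rk :: "('q, 'a) dfa \<Rightarrow> 'q \<Rightarrow> nat" where
  "rk A p = Max {length w | w. run A p w \<in> finals A}"

definition dfa_rank :: "('q, 'a) dfa \<Rightarrow> nat" where
  "dfa_rank A = Max (rk A ` states A)"

definition rank_class :: "('q, 'a) dfa \<Rightarrow> nat \<Rightarrow> 'q set" where
  "rank_class A l = {p \<in> states A. rk A p = l}"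

text \<open>
  \<open>back_seq A w\<close> lists the triples along the path labelled \<open>w\<close> from the initial state, the last
  transition first.
\<close>

definition back_seq :: "('q, 'a) dfa \<Rightarrow> 'a list \<Rightarrow> (nat \<times> 'a \<times> nat) list" where
  "back_seq A w =
     rev (map (\<lambda>i. let p = run A (start A) (take i w)
                   in (rk A p, w ! i, of_bool (p \<in> finals A)))
              [0..<length w])"

definition char_word :: "('q, 'a::{finite,linorder}) dfa \<Rightarrow> 'q \<Rightarrow> (nat \<times> 'a \<times> nat) list" where
  "char_word A p = Min {back_seq A w | w. run A (start A) w = p}"

text \<open>\<open>letter\<close> is the inverse of the order-preserving bijection from the alphabet to \<open>[0,k[\<close>.\<close>

definition letter :: "nat \<Rightarrow> 'a::{finite,linorder}" where
  "letter m = sorted_list_of_set (UNIV :: 'a set) ! m"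

text \<open>
  \<open>\<Delta>\<close> and \<open>\<prec>\<close> are parametrised by the numbering, since the numbering is built level by level
  from their values under the numbering of the lower levels.
\<close>

definition Delta ::
    "('q, 'a::{finite,linorder}) dfa \<Rightarrow> ('q \<Rightarrow> nat) \<Rightarrow> 'q \<Rightarrow> nat list" where
  "Delta A \<phi> p =
     map (\<lambda>m. \<phi> (delta A p (letter m))) [0..<card (UNIV :: 'a set)] @ [of_bool (p \<in> finals A)]"

definition prec ::
    "('q, 'a::{finite,linorder}) dfa \<Rightarrow> ('q \<Rightarrow> nat) \<Rightarrow> 'q \<Rightarrow> 'q \<Rightarrow> bool" where
  "prec A \<phi> p q \<longleftrightarrow>
     Delta A \<phi> p < Delta A \<phi> q \<or> Delta A \<phi> p = Delta A \<phi> q \<and> char_word A p < char_word A q"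

text \<open>
  \<open>num_below A l\<close> numbers the sink (by 0) and the states of rank less than \<open>l\<close>; its value 0 on
  the other states is a dummy. The numbers up to \<open>card {q \<in> states A. rk A q < l}\<close> are used up
  before level \<open>l\<close>, and a state of that level is then placed by counting its \<open>\<prec>\<close>-predecessors.
\<close>

primrec num_below :: "('q, 'a::{finite,linorder}) dfa \<Rightarrow> nat \<Rightarrow> 'q \<Rightarrow> nat" where
  "num_below A 0 = (\<lambda>_. 0)"
| "num_below A (Suc l) = (\<lambda>p.
     if p \<in> rank_class A l
     then card {q \<in> states A. rk A q < l}
          + card {q \<in> rank_class A l. prec A (num_below A l) q p} + 1
     else num_below A l p)"

definition numbering :: "('q, 'a::{finite,linorder}) dfa \<Rightarrow> 'q \<Rightarrow> nat" where
  "numbering A = num_below A (Suc (dfa_rank A))"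

definition state_of :: "('q, 'a::{finite,linorder}) dfa \<Rightarrow> nat \<Rightarrow> 'q" where
  "state_of A = inv_into (states A \<union> {sink A}) (numbering A)"

definition string_rep :: "('q, 'a::{finite,linorder}) dfa \<Rightarrow> nat list" where
  "string_rep A =
     concat (map (\<lambda>i. Delta A (numbering A) (state_of A i)) [0..<card (states A) + 1])"

text \<open>
  The index is an integer so that \<open>first_of_rank A (-1) = 0\<close>; above the rank of the automaton
  the value is that of the convention for \<open>d + 1\<close>.
\<close>

definition first_of_rank :: "('q, 'a::{finite,linorder}) dfa \<Rightarrow> int \<Rightarrow> nat" where
  "first_of_rank A l =
     (if l < 0 then 0
      else if l > int (dfa_rank A) then card (states A) + 1
      else Min (numbering A ` rank_class A (nat l)))"

definition transition_positions :: "('q, 'a::{finite,linorder}) dfa \<Rightarrow> nat set" where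
  "transition_positions A =
     {(card (UNIV :: 'a set) + 1) * j + m | j m. j \<le> card (states A) \<and> m < card (UNIV :: 'a set)}"

definition first_occ :: "('q, 'a::{finite,linorder}) dfa \<Rightarrow> nat \<Rightarrow> nat" where
  "first_occ A i = (LEAST p. p \<in> transition_positions A \<and> string_rep A ! p = i)"

end

theory Submission
  imports Defs "HOL-Library.Cardinality"
begin

text \<open>
  The rank strictly decreases along transitions between states, and every state of positive rank
  has a successor exactly one rank below; so all ranks up to that of the automaton occur, rank 0
  consists of final states with all transitions to the sink, and only the initial state has
  maximal rank. A word is recovered from its back sequence, so the characteristic word is
  injective and \<open>\<prec>\<close> is a strict total order on the states. The states of rank \<open>l\<close> are therefore
  numbered bijectively by the interval following the number of states of smaller rank, and
  comparing a number with these interval bounds is comparing ranks.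
\<close>

section \<open>Lists cut into equal blocks, and positions in a finite strict order\<close>

lemma nth_concat_uniform:
  assumes "\<And>xs. xs \<in> set xss \<Longrightarrow> length xs = c" and "i < length xss" and "m < c"
  shows "concat xss ! (c * i + m) = xss ! i ! m"
  using assms
proof (induction xss arbitrary: i)
  case (Cons xs xss)
  show ?case
  proof (cases i)
    case 0
    then show ?thesis using Cons.prems by (simp add: nth_append)
  next
    case (Suc j)
    have "length xs = c" using Cons.prems by simp
    then have "concat (xs # xss) ! (c * i + m) = concat xss ! (c * j + m)"
      using Suc by (simp add: nth_append)
    also have "\<dots> = xss ! j ! m" using Cons.IH[of j] Cons.prems Suc by simp
    finally show ?thesis using Suc by simp
  qed
qed simp

text \<open>If \<open>R x y\<close>, transitivity puts the predecessors of \<open>x\<close> among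
  those of \<open>y\<close>, and the inclusion is proper because \<open>x\<close> precedes
  \<open>y\<close> but not itself. Totality gives the converse.\<close>

lemma card_predecessors_less_iff:
  assumes "finite C" and "x \<in> C" and "y \<in> C"
    and irrefl: "\<And>x. x \<in> C \<Longrightarrow> \<not> R x x"
    and trans: "\<And>x y z. \<lbrakk>x \<in> C; y \<in> C; z \<in> C; R x y; R y z\<rbrakk> \<Longrightarrow> R x z"
    and total: "\<And>x y. \<lbrakk>x \<in> C; y \<in> C; x \<noteq> y\<rbrakk> \<Longrightarrow> R x y \<or> R y x"
  shows "card {z \<in> C. R z x} < card {z \<in> C. R z y} \<longleftrightarrow> R x y"
proof -
  have less: "card {z \<in> C. R z x} < card {z \<in> C. R z y}"
    if "x \<in> C" "y \<in> C" "R x y" for x y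
  proof (rule psubset_card_mono)
    show "finite {z \<in> C. R z y}" using \<open>finite C\<close> by simp
    have "{z \<in> C. R z x} \<subseteq> {z \<in> C. R z y}" using trans that by blast
    moreover have "x \<in> {z \<in> C. R z y} - {z \<in> C. R z x}" using irrefl that by blast
    ultimately show "{z \<in> C. R z x} \<subset> {z \<in> C. R z y}" by blast
  qed
  show ?thesis
    using less[of x y] less[of y x] total[of x y] assms(2,3) by (cases "x = y") (auto simp: irrefl)
qed

text \<open>Counts separate elements by totality, and each is below \<open>card C\<close> since no
  element precedes itself; an injection into a set of the same size is onto.\<close>

lemma card_predecessors_bij:
  assumes "finite C"
    and irrefl: "\<And>x. x \<in> C \<Longrightarrow> \<not> R x x"
    and trans: "\<And>x y z. \<lbrakk>x \<in> C; y \<in> C; z \<in> C; R x y; R y z\<rbrakk> \<Longrightarrow> R x z"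
    and total: "\<And>x y. \<lbrakk>x \<in> C; y \<in> C; x \<noteq> y\<rbrakk> \<Longrightarrow> R x y \<or> R y x"
  shows "bij_betw (\<lambda>x. card {z \<in> C. R z x}) C {..<card C}"
proof -
  have "card {z \<in> C. R z x} < card {z \<in> C. R z y} \<longleftrightarrow> R x y" if "x \<in> C" "y \<in> C" for x y
    using card_predecessors_less_iff[of C x y R] assms that by blast
  then have inj: "inj_on (\<lambda>x. card {z \<in> C. R z x}) C"
    using total by (metis (mono_tags, lifting) inj_onI less_irrefl)
  have "card {z \<in> C. R z x} < card C" if "x \<in> C" for x
    using that irrefl \<open>finite C\<close> by (intro psubset_card_mono) auto
  then have sub: "(\<lambda>x. card {z \<in> C. R z x}) ` C \<subseteq> {..<card C}" by blast
  have "(\<lambda>x. card {z \<in> C. R z x}) ` C = {..<card C}"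
    by (rule card_subset_eq[OF _ sub]) (simp_all add: card_image[OF inj])
  with inj show ?thesis by (simp add: bij_betw_def)
qed

section \<open>Letters, runs, back sequences and the order on states\<close>

lemma letter_surj:
  fixes a :: "'a::{finite,linorder}"
  obtains m where "m < CARD('a)" and "letter m = a"
proof -
  have "a \<in> set (sorted_list_of_set (UNIV :: 'a set))" by simp
  then show thesis
    using that unfolding letter_def in_set_conv_nth by auto
qed

lemma run_Nil [simp]: "run A p [] = p"
  by (simp add: run_def)

lemma run_Cons [simp]: "run A p (a # w) = run A (delta A p a) w"
  by (simp add: run_def)

lemma run_append [simp]: "run A p (v @ w) = run A (run A p v) w"
  by (simp add: run_def)

text \<open>The middle components of the triples, read from the last triple to the first, spell the
  word.\<close>

lemma back_seq_inj:
  assumes "back_seq A v = back_seq A w"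
  shows "v = w"
proof -
  have "map (fst \<circ> snd) (rev (back_seq A u)) = u" for u :: "'a list"
    by (rule nth_equalityI) (auto simp: back_seq_def Let_def)
  then show ?thesis using assms by metis
qed

lemma length_Delta [simp]:
  fixes A :: "('q, 'a::{finite,linorder}) dfa"
  shows "length (Delta A \<phi> p) = Suc CARD('a)"
  by (simp add: Delta_def)

lemma nth_Delta:
  fixes A :: "('q, 'a::{finite,linorder}) dfa"
  shows "m < CARD('a) \<Longrightarrow> Delta A \<phi> p ! m = \<phi> (delta A p (letter m))"
    and "Delta A \<phi> p ! CARD('a) = of_bool (p \<in> finals A)"
  by (simp_all add: Delta_def nth_append)

lemma prec_irrefl: "\<not> prec A \<phi> p p"
  by (simp add: prec_def)

lemma prec_trans: "prec A \<phi> p q \<Longrightarrow> prec A \<phi> q u \<Longrightarrow> prec A \<phi> p u"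
  unfolding prec_def by (auto intro: less_trans)

context adfa
begin

abbreviation n :: nat where "n \<equiv> card (states A)"
abbreviation d :: nat where "d \<equiv> dfa_rank A"
abbreviation Q :: "'q set" where "Q \<equiv> states A \<union> {sink A}"

section \<open>Words between states, and their finiteness\<close>

lemma start_state: "start A \<in> states A"
  using start_in start_not_sink by blast

lemma run_sink [simp]: "run A (sink A) w = sink A"
  by (induction w) (simp_all add: delta_sink)

lemma run_in_Q: "p \<in> Q \<Longrightarrow> run A p w \<in> Q"
proof (induction w arbitrary: p)
  case (Cons a w)
  show ?case using Cons.IH[OF delta_closed[OF Cons.prems]] by simp
qed simp

text \<open>A path that has entered the sink never leaves it.\<close>

lemma run_prefix_state:
  assumes "p \<in> Q" and "run A p (v @ w) \<in> states A"
  shows "run A p v \<in> states A"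
  using run_in_Q[OF assms(1), of v] assms(2) sink_notin by auto

text \<open>The \<open>length w + 1\<close> prefixes of \<open>w\<close> lead to distinct states: a
  repetition would close a nonempty cycle.\<close>

lemma length_less_card:
  assumes "p \<in> states A" and "run A p w \<in> states A"
  shows "length w < n"
proof -
  have st: "run A p (take i w) \<in> states A" for i
    using run_prefix_state[of p "take i w" "drop i w"] assms by simp
  have neq: "run A p (take i w) \<noteq> run A p (take j w)" if "i < j" "j \<le> length w" for i j
  proof -
    have "take j w = take i w @ drop i (take j w)"
      using that by (metis append_take_drop_id min.absorb1 less_imp_le take_take)
    then have "run A p (take j w) = run A (run A p (take i w)) (drop i (take j w))"
      by (metis run_append)
    then show ?thesis using acyclic[OF st[of i], of "drop i (take j w)"] that by auto
  qed
  have "inj_on (\<lambda>i. run A p (take i w)) {..length w}"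
    by (rule inj_onI) (metis neq atMost_iff linorder_neqE_nat)
  then have "card {..length w} \<le> n"
    using st finite_states by (intro card_inj_on_le) auto
  then show ?thesis by simp
qed

text \<open>Length is bounded and the alphabet is finite. This makes the maximum in
  \<open>rk\<close> and the minimum in \<open>char_word\<close> range over finite sets.\<close>

lemma finite_words:
  assumes "p \<in> states A"
  shows "finite {w. run A p w \<in> states A}"
proof (rule finite_subset)
  show "{w. run A p w \<in> states A} \<subseteq> {w. set w \<subseteq> UNIV \<and> length w \<le> n}"
    using length_less_card[OF assms] by (auto intro: less_imp_le)
  show "finite {w :: 'a list. set w \<subseteq> UNIV \<and> length w \<le> n}"
    by (rule finite_lists_length_le) simp
qed

section \<open>Ranks along transitions and the rank classes\<close>

lemma finite_accepted_lengths:
  assumes "p \<in> states A"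
  shows "finite {length w | w. run A p w \<in> finals A}"
proof (rule finite_subset)
  show "{length w | w. run A p w \<in> finals A} \<subseteq> length ` {w. run A p w \<in> states A}"
    using finals_subset by blast
qed (simp add: finite_words[OF assms])

lemma length_le_rk:
  assumes "p \<in> states A" and "run A p w \<in> finals A"
  shows "length w \<le> rk A p"
  unfolding rk_def using finite_accepted_lengths[OF assms(1)] assms(2)
  by (intro Max_ge) auto

lemma rk_attained:
  assumes "p \<in> states A"
  obtains w where "run A p w \<in> finals A" and "length w = rk A p"
proof -
  have "rk A p \<in> {length w | w. run A p w \<in> finals A}"
    unfolding rk_def using finite_accepted_lengths[OF assms] coaccessible[OF assms]
    by (intro Max_in) auto
  then show thesis using that by auto
qed

text \<open>Prepending \<open>v\<close> to a longest accepted word of the state reached gives a word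
  accepted from \<open>p\<close>.\<close>

lemma rk_run_le:
  assumes "p \<in> states A" and "run A p v \<in> states A"
  shows "length v + rk A (run A p v) \<le> rk A p"
proof -
  obtain w where "run A (run A p v) w \<in> finals A" "length w = rk A (run A p v)"
    using rk_attained[OF assms(2)] .
  then show ?thesis using length_le_rk[OF assms(1), of "v @ w"] by simp
qed

lemma rk_delta_less:
  assumes "p \<in> states A" and "delta A p a \<in> states A"
  shows "rk A (delta A p a) < rk A p"
  using rk_run_le[of p "[a]"] assms by simp

text \<open>The longest accepted word is empty, and a transition to a state would have to lower the
  rank below 0.\<close>

lemma rk_zero:
  assumes "p \<in> states A" and "rk A p = 0"
  shows "p \<in> finals A" and "delta A p a = sink A"
proof -
  show "p \<in> finals A" using rk_attained[OF assms(1)] assms(2) by (metis length_0_conv run_Nil)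
  show "delta A p a = sink A"
    using delta_closed[of p a] rk_delta_less[of p a] assms by auto
qed

text \<open>Take the first letter of a longest accepted word: the tail bounds the successor's rank
  from below, the strict decrease of ranks bounds it from above.\<close>

lemma rk_Suc_successor:
  assumes "p \<in> states A" and "rk A p = Suc l"
  obtains a where "delta A p a \<in> states A" and "rk A (delta A p a) = l"
proof -
  obtain w where w: "run A p w \<in> finals A" "length w = Suc l"
    using rk_attained[OF assms(1)] assms(2) by metis
  then obtain a v where v: "w = a # v" "length v = l" by (metis length_Suc_conv)
  have st: "delta A p a \<in> states A"
    using run_prefix_state[of p "[a]" v] w v assms finals_subset by auto
  have "l \<le> rk A (delta A p a)" using length_le_rk[OF st, of v] w v by simp
  moreover have "rk A (delta A p a) < Suc l" using rk_delta_less[OF assms(1) st] assms(2) by simp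
  ultimately show thesis using that st by simp
qed

lemma rk_le_dfa_rank: "p \<in> states A \<Longrightarrow> rk A p \<le> d"
  unfolding dfa_rank_def using finite_states by simp

text \<open>A word from the initial state to a different state is nonempty, so
  \<open>rk_run_le\<close> is strict here.\<close>

lemma rk_less_start:
  assumes "p \<in> states A" and "p \<noteq> start A"
  shows "rk A p < rk A (start A)"
proof -
  obtain w where "run A (start A) w = p" using accessible[OF assms(1)] by blast
  then show ?thesis using rk_run_le[OF start_state, of w] assms by (cases w) auto
qed

lemma rk_start: "rk A (start A) = d"
proof -
  have "rk A p \<le> rk A (start A)" if "p \<in> states A" for p
    using rk_less_start[OF that] by (cases "p = start A") auto
  then show ?thesis
    unfolding dfa_rank_def using finite_states start_state by (intro Max_eqI[symmetric]) auto
qed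

lemma rank_class_top: "rank_class A d = {start A}"
  using rk_less_start start_state rk_start by (fastforce simp: rank_class_def)

text \<open>Descending induction from the class of the initial state, each step passing to a
  successor exactly one rank lower.\<close>

lemma rank_class_nonempty: "l \<le> d \<Longrightarrow> rank_class A l \<noteq> {}"
proof (induction l rule: inc_induct)
  case base
  then show ?case by (simp add: rank_class_top)
next
  case (step l)
  then obtain p where "p \<in> states A" "rk A p = Suc l" by (auto simp: rank_class_def)
  then obtain a where "delta A p a \<in> states A" "rk A (delta A p a) = l"
    using rk_Suc_successor by blast
  then show ?case by (auto simp: rank_class_def)
qed

lemma finite_rank_class [simp]: "finite (rank_class A l)"
  by (simp add: rank_class_def finite_states)

section \<open>Characteristic words as tie-breakers\<close>

lemma char_word_attained:
  assumes "p \<in> states A"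
  obtains w where "run A (start A) w = p" and "char_word A p = back_seq A w"
proof -
  have "finite {w. run A (start A) w = p}"
    by (rule finite_subset[OF _ finite_words[OF start_state]]) (use assms in auto)
  then have "finite {back_seq A w | w. run A (start A) w = p}" by simp
  moreover have "{back_seq A w | w. run A (start A) w = p} \<noteq> {}"
    using accessible[OF assms] by blast
  ultimately have "char_word A p \<in> {back_seq A w | w. run A (start A) w = p}"
    unfolding char_word_def by (rule Min_in)
  then show thesis using that by blast
qed

text \<open>Both values are back sequences of words, which must then be the same word, and that word
  leads to only one state.\<close>

lemma char_word_inj:
  assumes "p \<in> states A" and "q \<in> states A" and "char_word A p = char_word A q"
  shows "p = q"
  using assms char_word_attained back_seq_inj by metis

lemma prec_total:
  assumes "p \<in> states A" and "q \<in> states A" and "p \<noteq> q"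
  shows "prec A \<phi> p q \<or> prec A \<phi> q p"
  using char_word_inj[OF assms(1,2)] assms(3) unfolding prec_def by (metis linorder_neqE)

section \<open>The numbering, level by level\<close>

lemma num_below_sink: "num_below A l (sink A) = 0"
  by (induction l) (simp_all add: rank_class_def sink_notin)

text \<open>A state is numbered at the level of its own rank; later levels change only their own
  classes.\<close>

lemma num_below_stable:
  assumes "rk A p < l"
  shows "num_below A l p = num_below A (Suc (rk A p)) p"
  using Suc_leI[OF assms]
proof (induction l rule: dec_induct)
  case (step l)
  then have "p \<notin> rank_class A l" by (auto simp: rank_class_def)
  then show ?case using step by simp
qed simp

lemma numbering_sink [simp]: "numbering A (sink A) = 0"
  unfolding numbering_def by (rule num_below_sink)

lemma num_below_eq_numbering:
  assumes "p \<in> states A" and "rk A p < l"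
  shows "num_below A l p = numbering A p"
  unfolding numbering_def
  using num_below_stable[OF assms(2)] num_below_stable[of p "Suc d"] rk_le_dfa_rank[OF assms(1)]
  by simp

text \<open>Transitions from rank \<open>l\<close> go to the sink or to lower ranks, whose numbers
  are already definitive at level \<open>l\<close>. So the order used in the construction is that of
  the finished numbering.\<close>

lemma Delta_num_below:
  assumes "p \<in> rank_class A l"
  shows "Delta A (num_below A l) p = Delta A (numbering A) p"
proof -
  have p: "p \<in> states A" "rk A p = l" using assms by (auto simp: rank_class_def)
  have "num_below A l (delta A p a) = numbering A (delta A p a)" for a
    using delta_closed[of p a] rk_delta_less[of p a] num_below_eq_numbering[of "delta A p a" l] p
    by (auto simp: num_below_sink)
  then show ?thesis by (simp add: Delta_def)
qed

text \<open>This is the offset of level \<open>l\<close> in \<open>num_below\<close>; the first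
  number of that level is \<open>below l + 1\<close>.\<close>

definition below :: "nat \<Rightarrow> nat" where
  "below l = card {q \<in> states A. rk A q < l}"

lemma below_0 [simp]: "below 0 = 0"
  by (simp add: below_def)

lemma below_Suc: "below (Suc l) = below l + card (rank_class A l)"
proof -
  have "{q \<in> states A. rk A q < Suc l} = {q \<in> states A. rk A q < l} \<union> rank_class A l"
    by (auto simp: rank_class_def)
  then show ?thesis unfolding below_def
    by (simp add: card_Un_disjoint finite_states rank_class_def disjoint_iff)
qed

lemma below_mono: "l \<le> m \<Longrightarrow> below l \<le> below m"
  unfolding below_def using finite_states by (intro card_mono) auto

lemma below_less_Suc: "l \<le> d \<Longrightarrow> below l < below (Suc l)"
  using rank_class_nonempty[of l] by (simp add: below_Suc card_gt_0_iff)

lemma below_top: "below (Suc d) = n"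
proof -
  have "{q \<in> states A. rk A q < Suc d} = states A"
    using rk_le_dfa_rank by (auto simp: less_Suc_eq_le)
  then show ?thesis by (simp add: below_def)
qed

text \<open>Frees the numbering from its recursion: the order on the right refers to the finished
  numbering.\<close>

lemma numbering_eq:
  assumes "p \<in> rank_class A l"
  shows "numbering A p = below l + card {q \<in> rank_class A l. prec A (numbering A) q p} + 1"
proof -
  have p: "p \<in> states A" "rk A p = l" using assms by (auto simp: rank_class_def)
  have "{q \<in> rank_class A l. prec A (num_below A l) q p}
      = {q \<in> rank_class A l. prec A (numbering A) q p}"
    using Delta_num_below assms by (auto simp: prec_def)
  then show ?thesis
    using num_below_eq_numbering[OF p(1), of "Suc l"] p(2) assms by (simp add: below_def)
qed

lemma numbering_less_iff:
  assumes "p \<in> rank_class A l" and "q \<in> rank_class A l"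
  shows "numbering A p < numbering A q \<longleftrightarrow> prec A (numbering A) p q"
proof -
  have "card {u \<in> rank_class A l. prec A (numbering A) u p}
        < card {u \<in> rank_class A l. prec A (numbering A) u q}
      \<longleftrightarrow> prec A (numbering A) p q"
    by (rule card_predecessors_less_iff[OF finite_rank_class assms], rule prec_irrefl,
        erule (1) prec_trans, rule prec_total) (simp_all add: rank_class_def)
  then show ?thesis using numbering_eq[OF assms(1)] numbering_eq[OF assms(2)] by linarith
qed

text \<open>Counting predecessors maps the class onto an initial segment of the naturals, which the
  offset then shifts.\<close>

lemma numbering_bij_rank_class:
  "bij_betw (numbering A) (rank_class A l) {below l<..below (Suc l)}"
proof -
  have 1: "bij_betw (\<lambda>p. card {q \<in> rank_class A l. prec A (numbering A) q p})
      (rank_class A l) {..<card (rank_class A l)}"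
    by (rule card_predecessors_bij[OF finite_rank_class], rule prec_irrefl,
        erule (1) prec_trans, rule prec_total) (simp_all add: rank_class_def)
  have 2: "bij_betw (\<lambda>x. below l + x + 1) {..<card (rank_class A l)} {below l<..below (Suc l)}"
    by (rule bij_betw_byWitness[where f' = "\<lambda>y. y - Suc (below l)"]) (auto simp: below_Suc)
  have "bij_betw ((\<lambda>x. below l + x + 1) \<circ>
      (\<lambda>p. card {q \<in> rank_class A l. prec A (numbering A) q p}))
      (rank_class A l) {below l<..below (Suc l)}"
    by (rule bij_betw_trans[OF 1 2])
  then show ?thesis
    by (rule bij_betw_cong[THEN iffD1, rotated]) (simp only: comp_def numbering_eq[symmetric])
qed

text \<open>Each number lies in the interval of its class, and \<open>below\<close> is monotone, so
  these intervals are ordered like the ranks.\<close>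

lemma numbering_le_below_iff:
  assumes "p \<in> states A"
  shows "numbering A p \<le> below l \<longleftrightarrow> rk A p < l"
proof -
  have "p \<in> rank_class A (rk A p)" using assms by (simp add: rank_class_def)
  then have "below (rk A p) < numbering A p" "numbering A p \<le> below (Suc (rk A p))"
    using numbering_bij_rank_class[of "rk A p"] by (auto dest: bij_betwE)
  then show ?thesis
    using below_mono[of "Suc (rk A p)" l] below_mono[of l "rk A p"]
    by (cases "rk A p < l") auto
qed

text \<open>Equal numbers satisfy the same bounds \<open>below l\<close>, which forces equal ranks;
  inside one class injectivity is known.\<close>

lemma numbering_inj_states: "inj_on (numbering A) (states A)"
proof (rule inj_onI)
  fix p q assume pq: "p \<in> states A" "q \<in> states A" "numbering A p = numbering A q"
  then have "rk A p = rk A q"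
    using numbering_le_below_iff[of p] numbering_le_below_iff[of q] by (metis linorder_neqE_nat less_irrefl)
  then show "p = q"
    using pq numbering_bij_rank_class[of "rk A p"]
    by (auto simp: bij_betw_def rank_class_def dest: inj_onD)
qed

lemma numbering_pos: "p \<in> states A \<Longrightarrow> 0 < numbering A p"
  using numbering_le_below_iff[of p 0] by simp

lemma numbering_image_states: "numbering A ` states A = {1..n}"
proof (rule card_subset_eq)
  show "numbering A ` states A \<subseteq> {1..n}"
    using numbering_pos numbering_le_below_iff[of _ "Suc d"] rk_le_dfa_rank
    by (auto simp: below_top Suc_le_eq less_Suc_eq_le)
  show "card (numbering A ` states A) = card {1..n}"
    using card_image[OF numbering_inj_states] by simp
qed simp

lemma numbering_inj: "inj_on (numbering A) Q"
  using numbering_inj_states by (auto simp: inj_on_Un dest: numbering_pos)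

lemma state_of_numbering: "p \<in> Q \<Longrightarrow> state_of A (numbering A p) = p"
  unfolding state_of_def by (rule inv_into_f_f[OF numbering_inj])

lemma state_of_0: "state_of A 0 = sink A"
  using state_of_numbering[of "sink A"] by simp

lemma state_of_in_states:
  assumes "1 \<le> i" and "i \<le> n"
  shows "state_of A i \<in> states A" and "numbering A (state_of A i) = i"
proof -
  obtain p where "p \<in> states A" "numbering A p = i"
    using assms equalityD2[OF numbering_image_states] by force
  then show "state_of A i \<in> states A" and "numbering A (state_of A i) = i"
    using state_of_numbering[of p] by auto
qed

text \<open>The initial state is alone in the top class, whose interval ends at
  \<open>n\<close>.\<close>

lemma numbering_start: "numbering A (start A) = n"
proof -
  have "start A \<in> rank_class A d" by (simp add: rank_class_top)
  then have "numbering A (start A) \<in> {below d<..below (Suc d)}"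
    using numbering_bij_rank_class bij_betwE by blast
  then show ?thesis using below_Suc[of d] below_top by (simp add: rank_class_top)
qed

lemma n_pos: "0 < n"
  using start_state finite_states by (auto simp: card_gt_0_iff)

section \<open>First states of the ranks\<close>

lemma first_of_rank_nat:
  assumes "l \<le> Suc d"
  shows "first_of_rank A (int l) = Suc (below l)"
proof (cases "l \<le> d")
  case True
  have "numbering A ` rank_class A l = {below l<..below (Suc l)}"
    using numbering_bij_rank_class by (simp add: bij_betw_def)
  moreover have "Min {below l<..below (Suc l)} = Suc (below l)"
    using below_less_Suc[OF True] by (intro Min_eqI) auto
  ultimately show ?thesis using True by (simp add: first_of_rank_def)
next
  case False
  \<comment> \<open>All \<open>n\<close> states have rank below \<open>d + 1\<close>, so the
    convention \<open>n + 1\<close> fits the general formula.\<close>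
  then have "l = Suc d" using assms by simp
  then show ?thesis by (simp add: first_of_rank_def below_top)
qed

lemma first_of_rank_neg [simp]: "l < 0 \<Longrightarrow> first_of_rank A l = 0"
  by (simp add: first_of_rank_def)

lemma rk_state_of:
  assumes "l \<le> d" and "i \<in> {first_of_rank A (int l)..<first_of_rank A (int l + 1)}"
  shows "1 \<le> i" and "i \<le> n" and "state_of A i \<in> states A" and "rk A (state_of A i) = l"
proof -
  have i: "below l < i" "i \<le> below (Suc l)"
    using assms first_of_rank_nat[of l] first_of_rank_nat[of "Suc l"] by (auto simp: add.commute)
  show 1: "1 \<le> i" and 2: "i \<le> n"
    using i below_mono[of "Suc l" "Suc d"] assms(1) by (auto simp: below_top)
  show st: "state_of A i \<in> states A" using state_of_in_states(1)[OF 1 2] .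
  show "rk A (state_of A i) = l"
    using numbering_le_below_iff[OF st, of l] numbering_le_below_iff[OF st, of "Suc l"] i
      state_of_in_states(2)[OF 1 2] by simp
qed

section \<open>Entries of the string representation\<close>

lemma length_string_rep: "length (string_rep A) = (CARD('a) + 1) * (n + 1)"
  by (simp add: string_rep_def length_concat comp_def sum_list_triv)

lemma nth_string_rep:
  assumes "j \<le> n" and "m \<le> CARD('a)"
  shows "string_rep A ! ((CARD('a) + 1) * j + m) = Delta A (numbering A) (state_of A j) ! m"
proof -
  have "string_rep A ! ((CARD('a) + 1) * j + m)
      = map (\<lambda>i. Delta A (numbering A) (state_of A i)) [0..<n + 1] ! j ! m"
    unfolding string_rep_def by (rule nth_concat_uniform) (use assms in auto)
  also have "\<dots> = Delta A (numbering A) (state_of A j) ! m"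
    using assms by (simp del: upt_Suc)
  finally show ?thesis .
qed

lemma string_rep_transition:
  assumes "j \<le> n" and "m < CARD('a)"
  shows "string_rep A ! ((CARD('a) + 1) * j + m) = numbering A (delta A (state_of A j) (letter m))"
  using assms nth_string_rep[of j m] by (simp add: nth_Delta)

lemma string_rep_final:
  assumes "j \<le> n"
  shows "string_rep A ! ((CARD('a) + 1) * j + CARD('a)) = of_bool (state_of A j \<in> finals A)"
  using assms nth_string_rep[of j "CARD('a)"] by (simp add: nth_Delta)

text \<open>The source of such a transition would have rank above the maximum
  \<open>d\<close>.\<close>

lemma delta_not_start:
  assumes "p \<in> Q"
  shows "delta A p a \<noteq> start A"
proof
  assume eq: "delta A p a = start A"
  then have "p \<in> states A" using assms delta_sink start_not_sink by auto
  then have "rk A (start A) < rk A p" using rk_delta_less[of p a] eq start_state by simp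
  then show False using rk_le_dfa_rank[OF \<open>p \<in> states A\<close>] rk_start by simp
qed

text \<open>The value \<open>n\<close> belongs to the initial state, which no transition
  enters.\<close>

lemma numbering_delta_less:
  assumes "p \<in> Q"
  shows "numbering A (delta A p a) < n"
proof -
  have q: "delta A p a \<in> Q" using delta_closed[OF assms] .
  have "numbering A (delta A p a) \<noteq> n"
    using inj_onD[OF numbering_inj, of "delta A p a" "start A"] q start_state numbering_start
      delta_not_start[OF assms] by auto
  moreover have "numbering A (delta A p a) \<le> n"
    using q numbering_image_states n_pos by fastforce
  ultimately show ?thesis by simp
qed

lemma state_of_in_Q: "j \<le> n \<Longrightarrow> state_of A j \<in> Q"
  using state_of_0 state_of_in_states(1)[of j] by (cases "j = 0") auto

text \<open>Cut off the last letter of a word leading from the initial state to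
  \<open>p\<close>.\<close>

lemma predecessor:
  assumes "p \<in> states A" and "p \<noteq> start A"
  obtains q a where "q \<in> states A" and "delta A q a = p"
proof -
  obtain w where w: "run A (start A) w = p" using accessible[OF assms(1)] by blast
  then have "w \<noteq> []" using assms(2) by auto
  then obtain v a where v: "w = v @ [a]" by (metis rev_exhaust)
  show thesis
  proof (rule that)
    show "run A (start A) v \<in> states A"
      using run_prefix_state[of "start A" v "[a]"] start_state w v assms(1) by simp
    show "delta A (run A (start A) v) a = p" using w v by simp
  qed
qed

section \<open>First occurrences\<close>

lemma transition_positionE:
  assumes "p \<in> transition_positions A"
  obtains j m where "p = (CARD('a) + 1) * j + m" and "j \<le> n" and "m < CARD('a)"
  using assms unfolding transition_positions_def by blast

text \<open>State \<open>i\<close> is not the initial one, so some transition enters it; the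
  position of that transition shows that the \<open>LEAST\<close> in \<open>first_occ\<close> is
  over a nonempty set.\<close>

lemma first_occ_props:
  assumes "1 \<le> i" and "i < n"
  shows "first_occ A i \<in> transition_positions A" and "string_rep A ! first_occ A i = i"
proof -
  have st: "state_of A i \<in> states A" "numbering A (state_of A i) = i"
    using state_of_in_states[of i] assms by auto
  then have "state_of A i \<noteq> start A" using numbering_start assms by auto
  then obtain q a where q: "q \<in> states A" "delta A q a = state_of A i"
    using predecessor st(1) by blast
  obtain m where m: "m < CARD('a)" "letter m = a" by (rule letter_surj)
  have j: "numbering A q \<le> n" using q(1) numbering_image_states by auto
  have "string_rep A ! ((CARD('a) + 1) * numbering A q + m) = i"
    using string_rep_transition[OF j m(1)] state_of_numbering[of q] q m st by simp
  moreover have "(CARD('a) + 1) * numbering A q + m \<in> transition_positions A"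
    unfolding transition_positions_def using j m by blast
  ultimately have "\<exists>p. p \<in> transition_positions A \<and> string_rep A ! p = i" by blast
  then have "first_occ A i \<in> transition_positions A \<and> string_rep A ! first_occ A i = i"
    unfolding first_occ_def by (rule LeastI_ex)
  then show "first_occ A i \<in> transition_positions A" and "string_rep A ! first_occ A i = i"
    by auto
qed

lemma before_first_occ:
  assumes "j \<le> n" and "m < CARD('a)" and "(CARD('a) + 1) * j + m < first_occ A i"
  shows "string_rep A ! ((CARD('a) + 1) * j + m) \<noteq> i"
proof
  assume "string_rep A ! ((CARD('a) + 1) * j + m) = i"
  moreover have "(CARD('a) + 1) * j + m \<in> transition_positions A"
    using assms unfolding transition_positions_def by blast
  ultimately have "first_occ A i \<le> (CARD('a) + 1) * j + m"
    unfolding first_occ_def by (intro Least_le) simp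
  then show False using assms(3) by simp
qed

section \<open>The conditions one by one\<close>

lemma string_rep_less:
  assumes "2 \<le> n" and "i < (CARD('a) + 1) * (n + 1)"
  shows "string_rep A ! i < n"
proof -
  \<comment> \<open>Block \<open>j\<close> describes the state numbered \<open>j\<close>, and
    \<open>m\<close> is the offset inside it.\<close>
  define j m where "j = i div (CARD('a) + 1)" and "m = i mod (CARD('a) + 1)"
  have i: "i = (CARD('a) + 1) * j + m" unfolding j_def m_def by (simp only: mult_div_mod_eq)
  have m: "m \<le> CARD('a)" unfolding m_def using mod_less_divisor[of "CARD('a) + 1" i] by linarith
  have "j < n + 1" unfolding j_def using assms(2)
    by (intro less_mult_imp_div_less) (simp only: mult.commute)
  then have j: "j \<le> n" by simp
  show ?thesis
  proof (cases "m = CARD('a)")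
    \<comment> \<open>The last entry of a block is a finality bit, and 1 is below \<open>n\<close>
      because \<open>2 \<le> n\<close>.\<close>
    case True
    then show ?thesis using string_rep_final[OF j] i assms(1) by simp
  next
    case False
    then show ?thesis
      using string_rep_transition[OF j, of m] i m numbering_delta_less[OF state_of_in_Q[OF j]]
      by simp
  qed
qed

lemma rk_state_of_1: "rk A (state_of A 1) = 0"
  using below_less_Suc[of 0] state_of_in_states[of 1] n_pos
    numbering_le_below_iff[of "state_of A 1" 1] by simp

text \<open>These positions cover the whole block of the sink, which is not final, and the
  transitions of state 1, which has rank 0 and so leads only to the sink.\<close>

lemma string_rep_init_0:
  assumes "i \<le> 2 * CARD('a)"
  shows "string_rep A ! i = 0"
proof -
  have st: "state_of A 1 \<in> states A" using state_of_in_states(1)[of 1] n_pos by simp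
  consider "i < CARD('a)" | "i = CARD('a)" | m where "m < CARD('a)" "i = (CARD('a) + 1) * 1 + m"
  proof -
    assume *: "i < CARD('a) \<Longrightarrow> thesis" "i = CARD('a) \<Longrightarrow> thesis"
      "\<And>m. m < CARD('a) \<Longrightarrow> i = (CARD('a) + 1) * 1 + m \<Longrightarrow> thesis"
    show thesis using * *(3)[of "i - (CARD('a) + 1)"] assms by fastforce
  qed
  then show ?thesis
  proof cases
    case 1
    then show ?thesis using string_rep_transition[of 0 i] by (simp add: state_of_0 delta_sink)
  next
    case 2
    then show ?thesis
      using string_rep_final[of 0] finals_subset sink_notin by (auto simp: state_of_0)
  next
    case 3
    then show ?thesis
      using string_rep_transition[of 1 m] rk_zero(2)[OF st rk_state_of_1] n_pos by simp
  qed
qed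

lemma string_rep_first_final: "string_rep A ! (2 * CARD('a) + 1) = 1"
proof -
  have "state_of A 1 \<in> finals A"
    using rk_zero(1) rk_state_of_1 state_of_in_states(1)[of 1] n_pos by simp
  moreover have "2 * CARD('a) + 1 = (CARD('a) + 1) * 1 + CARD('a)" by simp
  ultimately show ?thesis using string_rep_final[of 1] n_pos by (simp only:) simp
qed

lemma first_of_rank_0: "first_of_rank A 0 = 1"
  using first_of_rank_nat[of 0] by simp

text \<open>The automaton may be non-minimal and have several states of rank 0, all with the same
  \<open>Delta\<close>; the value 2 arises when there is just one.\<close>

lemma first_of_rank_1:
  assumes "2 \<le> n" and "card (rank_class A 0) = 1"
  shows "first_of_rank A 1 = 2"
  using first_of_rank_nat[of 1] assms below_Suc[of 0] by simp

lemma first_of_rank_top: "first_of_rank A (int d) = n"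
  using first_of_rank_nat[of d] below_Suc[of d] below_top by (simp add: rank_class_top)

lemma first_of_rank_strict_mono:
  assumes "0 \<le> l" and "l < int d"
  shows "first_of_rank A l < first_of_rank A (l + 1)"
proof -
  obtain m where m: "l = int m" using assms(1) nonneg_int_cases by blast
  then have "m < d" using assms(2) by simp
  then show ?thesis
    using first_of_rank_nat[of m] first_of_rank_nat[of "Suc m"] below_less_Suc[of m] m
    by (simp add: add.commute)
qed

text \<open>The transition at the first occurrence leaves a state of rank above \<open>l\<close>, so
  its block index \<open>j\<close> is at least the first number of rank
  \<open>l + 1\<close>.\<close>

lemma first_occ_ge:
  assumes "l < d" and "i \<in> {first_of_rank A (int l)..<first_of_rank A (int l + 1)}"
  shows "CARD('a) * first_of_rank A (int l + 1) + 1 \<le> first_occ A i"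
proof -
  have i: "1 \<le> i" "i \<le> n" "state_of A i \<in> states A" "rk A (state_of A i) = l"
    using rk_state_of[of l i] assms by auto
  have num: "numbering A (state_of A i) = i" using state_of_in_states(2) i by blast
  have "state_of A i \<noteq> start A" using i(4) rk_start assms(1) by auto
  then have "i < n"
    using i(2,3) num inj_onD[OF numbering_inj_states, of "state_of A i" "start A"] start_state
      numbering_start by fastforce
  note occ = first_occ_props[OF i(1) this]
  obtain j m where jm: "first_occ A i = (CARD('a) + 1) * j + m" "j \<le> n" "m < CARD('a)"
    using transition_positionE[OF occ(1)] .
  define q where "q = state_of A j"
  have q: "q \<in> Q" unfolding q_def using state_of_in_Q[OF jm(2)] .
  have "numbering A (delta A q (letter m)) = i"
    using string_rep_transition[OF jm(2,3)] occ(2) jm(1) by (simp add: q_def)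
  then have dq: "delta A q (letter m) = state_of A i"
    using state_of_numbering[OF delta_closed[OF q]] by auto
  \<comment> \<open>The sink has only loops, so a transition into a state starts at a state.\<close>
  then have qs: "q \<in> states A" using q delta_sink i(3) sink_notin by auto
  have "l < rk A q" using rk_delta_less[OF qs, of "letter m"] dq i by simp
  then have "below (Suc l) < numbering A q"
    using numbering_le_below_iff[OF qs, of "Suc l"] by simp
  moreover have "numbering A q = j"
    using qs jm(2) state_of_0 sink_notin state_of_in_states(2)[of j]
    unfolding q_def by (cases "j = 0") auto
  ultimately have j: "first_of_rank A (int l + 1) \<le> j" "1 \<le> j"
    using first_of_rank_nat[of "Suc l"] assms(1) by (simp_all add: add.commute)
  have "CARD('a) * first_of_rank A (int l + 1) \<le> CARD('a) * j"
    by (rule mult_le_mono2[OF j(1)])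
  \<comment> \<open>In \<open>(k + 1) * j = k * j + j\<close> the second summand, at least 1,
    supplies the \<open>+ 1\<close>.\<close>
  then show ?thesis unfolding jm(1) add_mult_distrib using j(2) by linarith
qed

text \<open>For positive rank, a successor one rank below provides the transition. For rank 0 the
  target interval contains only 0, by the convention at index -1, and all transitions go to the
  sink.\<close>

lemma transition_to_previous_rank:
  assumes "l \<le> d" and "i \<in> {first_of_rank A (int l)..<first_of_rank A (int l + 1)}"
  shows "\<exists>m<CARD('a). string_rep A ! ((CARD('a) + 1) * i + m)
      \<in> {first_of_rank A (int l - 1)..<first_of_rank A (int l)}"
proof -
  have i: "1 \<le> i" "i \<le> n" "state_of A i \<in> states A" "rk A (state_of A i) = l"
    using rk_state_of[OF assms] by auto
  show ?thesis
  proof (cases l)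
    case 0
    \<comment> \<open>Offset 0 is a transition position because the alphabet type is
      nonempty.\<close>
    then have "string_rep A ! ((CARD('a) + 1) * i + 0) = 0"
      using string_rep_transition[OF i(2) zero_less_card_finite] rk_zero(2)[OF i(3)] i(4) by simp
    then show ?thesis using zero_less_card_finite 0 first_of_rank_0 by (intro exI[of _ 0]) simp
  next
    case (Suc m)
    obtain a where a: "delta A (state_of A i) a \<in> states A" "rk A (delta A (state_of A i) a) = m"
      using rk_Suc_successor[OF i(3)] i(4) Suc by blast
    obtain c where c: "c < CARD('a)" "letter c = a" by (rule letter_surj)
    have "string_rep A ! ((CARD('a) + 1) * i + c) = numbering A (delta A (state_of A i) a)"
      using string_rep_transition[OF i(2) c(1)] c(2) by simp
    moreover have "below m < numbering A (delta A (state_of A i) a)"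
      "numbering A (delta A (state_of A i) a) \<le> below (Suc m)"
      using numbering_le_below_iff[OF a(1), of m] numbering_le_below_iff[OF a(1), of "Suc m"] a(2)
      by simp_all
    moreover have "first_of_rank A (int l - 1) = Suc (below m)"
      "first_of_rank A (int l) = Suc (below (Suc m))"
      using first_of_rank_nat[of m] first_of_rank_nat[of l] assms(1) Suc by auto
    ultimately show ?thesis using c(1) by (intro exI[of _ c]) simp
  qed
qed

text \<open>Both numbers must belong to one class: the numbering follows the rank first, and across
  two ranks the order can be reversed.\<close>

lemma prec_consecutive:
  assumes "i \<in> numbering A ` rank_class A l" and "i + 1 \<in> numbering A ` rank_class A l"
  shows "prec A (numbering A) (state_of A i) (state_of A (i + 1))"
proof -
  obtain p q where pq: "p \<in> rank_class A l" "q \<in> rank_class A l"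
    "i = numbering A p" "i + 1 = numbering A q"
    using assms by blast
  then have "state_of A i = p" "state_of A (i + 1) = q"
    using state_of_numbering by (auto simp: rank_class_def)
  then show ?thesis using numbering_less_iff[OF pq(1,2)] pq(3,4) by simp
qed

end

section \<open>All conditions together, with integer indices for \<open>r\<close>\<close>

theorem theorem2:
  fixes A :: "('q, 'a::{finite,linorder}) dfa"
    and k n d :: nat and \<phi> :: "'q \<Rightarrow> nat" and s :: "nat list"
    and r :: "int \<Rightarrow> nat" and f :: "nat \<Rightarrow> nat"
  assumes "adfa A"
    and "k = card (UNIV :: 'a set)"
    and "n = card (states A)" and "n \<ge> 2"
    and "dfa_rank A = d"
    and "\<phi> = numbering A"
    and "s = string_rep A"
    and "r = first_of_rank A"
    and "f = first_occ A"
  shows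
    "(\<comment> \<open>the string and the positions \<open>f i\<close> are as announced\<close>
      length s = (k + 1) * (n + 1) \<and> (\<forall>i < (k + 1) * (n + 1). s ! i < n) \<and>
      (\<forall>i\<in>{1..<n}. f i \<in> transition_positions A)) \<and>
     (\<comment> \<open>N0\<close>
      (\<forall>i \<le> 2 * k. s ! i = 0) \<and> s ! (2 * k + 1) = 1) \<and>
     (\<comment> \<open>N1\<close>
      \<forall>i \<le> n. s ! ((k + 1) * i + k) \<in> {0, 1}) \<and>
     (\<comment> \<open>N2\<close>
      r 0 = 1 \<and> (card (rank_class A 0) = 1 \<longrightarrow> r 1 = 2) \<and> r (int d) = n \<and>
      (\<forall>l\<in>{0..<int d}. r l < r (l + 1))) \<and>
     (\<comment> \<open>N3\<close>
      \<forall>i\<in>{1..<n}. s ! f i = i \<and>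
        (\<forall>j \<le> n. \<forall>m < k. (k + 1) * j + m < f i \<longrightarrow> s ! ((k + 1) * j + m) \<noteq> i)) \<and>
     (\<comment> \<open>N4\<close>
      \<forall>l\<in>{0..<int d}. \<forall>i\<in>{r l..<r (l + 1)}. k * r (l + 1) + 1 \<le> f i) \<and>
     (\<comment> \<open>N5\<close>
      \<forall>l\<in>{0..int d}. \<forall>i\<in>{r l..<r (l + 1)}.
        \<exists>m < k. s ! ((k + 1) * i + m) \<in> {r (l - 1)..<r l}) \<and>
     (\<comment> \<open>N6'\<close>
      \<forall>l < d. \<forall>i \<in> \<phi> ` rank_class A l. i + 1 \<in> \<phi> ` rank_class A l \<longrightarrow>
        prec A \<phi> (state_of A i) (state_of A (i + 1)))"
proof -
  interpret adfa A by fact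
  have string: "length s = (k + 1) * (n + 1) \<and> (\<forall>i < (k + 1) * (n + 1). s ! i < n) \<and>
      (\<forall>i\<in>{1..<n}. f i \<in> transition_positions A)"
    using length_string_rep string_rep_less first_occ_props(1) assms by auto
  have N0: "(\<forall>i \<le> 2 * k. s ! i = 0) \<and> s ! (2 * k + 1) = 1"
    using string_rep_init_0 string_rep_first_final assms by simp
  have N1: "\<forall>i \<le> n. s ! ((k + 1) * i + k) \<in> {0, 1}"
    using string_rep_final assms by simp
  have N2: "r 0 = 1 \<and> (card (rank_class A 0) = 1 \<longrightarrow> r 1 = 2) \<and> r (int d) = n \<and>
      (\<forall>l\<in>{0..<int d}. r l < r (l + 1))"
    using first_of_rank_0 first_of_rank_1 first_of_rank_top first_of_rank_strict_mono assms
    by auto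
  have N3: "\<forall>i\<in>{1..<n}. s ! f i = i \<and>
        (\<forall>j \<le> n. \<forall>m < k. (k + 1) * j + m < f i \<longrightarrow> s ! ((k + 1) * j + m) \<noteq> i)"
    using first_occ_props(2) before_first_occ assms by simp
  have N4: "\<forall>l\<in>{0..<int d}. \<forall>i\<in>{r l..<r (l + 1)}. k * r (l + 1) + 1 \<le> f i"
  proof (intro ballI)
    fix l i assume l: "l \<in> {0..<int d}" and i: "i \<in> {r l..<r (l + 1)}"
    \<comment> \<open>The index of \<open>r\<close> is a nonnegative integer here, so it is
      converted to the natural rank for which the bound was shown.\<close>
    then have "nat l < dfa_rank A" "int (nat l) = l" using assms by auto
    then show "k * r (l + 1) + 1 \<le> f i" using first_occ_ge[of "nat l" i] i assms by simp
  qed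
  have N5: "\<forall>l\<in>{0..int d}. \<forall>i\<in>{r l..<r (l + 1)}.
        \<exists>m < k. s ! ((k + 1) * i + m) \<in> {r (l - 1)..<r l}"
  proof (intro ballI)
    fix l i assume l: "l \<in> {0..int d}" and i: "i \<in> {r l..<r (l + 1)}"
    then have "nat l \<le> dfa_rank A" "int (nat l) = l" using assms by auto
    then show "\<exists>m < k. s ! ((k + 1) * i + m) \<in> {r (l - 1)..<r l}"
      using transition_to_previous_rank[of "nat l" i] i assms by simp
  qed
  have N6: "\<forall>l < d. \<forall>i \<in> \<phi> ` rank_class A l. i + 1 \<in> \<phi> ` rank_class A l \<longrightarrow>
        prec A \<phi> (state_of A i) (state_of A (i + 1))"
    using prec_consecutive assms by blast
  from string N0 N1 N2 N3 N4 N5 N6 show ?thesis by (intro conjI) auto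
qed

end
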